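(* Let $L$ be an infinite locally compact Hausdorff topological space that is non-compact. Then every somewhat regular linear subspace of $C_0(L)$ (with the supremum norm) is almost square.
   Context: $\mathbb{K}$ denotes either $\mathbb{R}$ or $\mathbb{C}$, and $C_0(L)$ is the Banach space of continuous $\mathbb{K}$-valued functions on $L$ vanishing at infinity, with the supremum norm. A linear subspace $\mathcal{A}$ of $C_0(L)$ (not necessarily closed) is called somewhat regular if, whenever $V$ is a non-empty open subset of $L$ and $0<\varepsilon<1$, there is an $f\in\mathcal{A}$ such that $\|f\|=1$ and $|f(x)|\leq\varepsilon$ for every $x\in L\setminus V$. A normed space $X$ with closed unit ball $B_X$ and unit sphere $S_X$ is almost square (ASQ) if whenever $n\in\mathbb{N}$ and $x_1,\dots,x_n\in S_X$, there exists a sequence $(y_k)$ in $B_X$ such that $\|x_i\pm y_k\|\to 1$ as $k\to\infty$ for every $i\in\{1,\dots,n\}$ (for both choices of sign) and $\|y_k\|\to 1$ as $k\to\infty$. *)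

theory Defs
  imports "HOL-Analysis.Analysis"
begin

text \<open>
  The library's type of bounded continuous functions carries the supremum norm, but only real
  scalars. Pointwise multiplication by elements of the scalar field is added here, so that complex
  linear subspaces can be expressed. Only the instances real and complex are intended.
\<close>

context
  includes bcontfun.lifting
begin

lift_definition scale_bcontfun ::
    "'k::real_normed_field \<Rightarrow> ('a::topological_space \<Rightarrow>\<^sub>C 'k) \<Rightarrow> ('a \<Rightarrow>\<^sub>C 'k)"
  is "\<lambda>c f x. c * f x"
proof -
  fix c :: 'k and f :: "'a \<Rightarrow> 'k"
  assume "f \<in> bcontfun"
  then have cont: "continuous_on UNIV f" and "bounded (range f)"
    by (auto simp: bcontfun_def)
  then obtain B where B: "\<And>x. norm (f x) \<le> B"
    by (auto simp: bounded_iff)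
  show "(\<lambda>x. c * f x) \<in> bcontfun"
  proof (rule bcontfun_normI)
    show "continuous_on UNIV (\<lambda>x. c * f x)"
      using cont by (intro continuous_intros)
    show "norm (c * f x) \<le> norm c * B" for x
      by (simp add: norm_mult mult_left_mono B)
  qed
qed

end

global_interpretation bcontfun: vector_space scale_bcontfun
  defines bcontfun_subspace = bcontfun.subspace
  by standard (auto intro!: bcontfun_eqI simp: scale_bcontfun.rep_eq algebra_simps)

definition vanishes_at_infinity ::
    "('a::topological_space \<Rightarrow> 'k::real_normed_vector) \<Rightarrow> bool"
  where "vanishes_at_infinity f \<longleftrightarrow> (\<forall>\<epsilon>>0. compact {x. \<epsilon> \<le> norm (f x)})"

definition C0 :: "('a::topological_space \<Rightarrow>\<^sub>C 'k::real_normed_field) set"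
  where "C0 = {f. vanishes_at_infinity (apply_bcontfun f)}"

text \<open>
  Restricting to bounded functions loses nothing: a continuous function that vanishes at infinity
  is automatically bounded.
\<close>

lemma vanishes_at_infinity_imp_bcontfun:
  fixes f :: "'a::topological_space \<Rightarrow> 'k::real_normed_field"
  assumes cont: "continuous_on UNIV f" and van: "vanishes_at_infinity f"
  shows "f \<in> bcontfun"
proof -
  have "compact {x. 1 \<le> norm (f x)}"
    using van by (simp add: vanishes_at_infinity_def)
  then have "compact (f ` {x. 1 \<le> norm (f x)})"
    using cont by (meson compact_continuous_image continuous_on_subset subset_UNIV)
  then obtain B where B: "\<And>x. 1 \<le> norm (f x) \<Longrightarrow> norm (f x) \<le> B"
    using compact_imp_bounded[of "f ` {x. 1 \<le> norm (f x)}"] unfolding bounded_iff by blast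
  have "norm (f x) \<le> max 1 B" for x
    using B[of x] by fastforce
  with cont show ?thesis
    by (rule bcontfun_normI)
qed

definition somewhat_regular :: "('a::topological_space \<Rightarrow>\<^sub>C 'k::real_normed_field) set \<Rightarrow> bool"
  where "somewhat_regular A \<longleftrightarrow> bcontfun_subspace A \<and> A \<subseteq> C0 \<and>
    (\<forall>V \<epsilon>. open V \<and> V \<noteq> {} \<and> 0 < \<epsilon> \<and> \<epsilon> < 1 \<longrightarrow>
      (\<exists>f\<in>A. norm f = 1 \<and> (\<forall>x\<in>- V. norm (apply_bcontfun f x) \<le> \<epsilon>)))"

text \<open>
  The argument is the carrier of a linear subspace of an ambient normed space, regarded as a normed
  space in its own right with the restricted norm.
\<close>

definition almost_square :: "'v::real_normed_vector set \<Rightarrow> bool"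
  where "almost_square X \<longleftrightarrow>
    (\<forall>n\<ge>1. \<forall>x :: nat \<Rightarrow> 'v. (\<forall>i\<in>{1..n}. x i \<in> X \<and> norm (x i) = 1) \<longrightarrow>
      (\<exists>y :: nat \<Rightarrow> 'v. (\<forall>k. y k \<in> X \<and> norm (y k) \<le> 1) \<and>
        (\<forall>i\<in>{1..n}. (\<lambda>k. norm (x i + y k)) \<longlonglongrightarrow> 1 \<and> (\<lambda>k. norm (x i - y k)) \<longlonglongrightarrow> 1) \<and>
        (\<lambda>k. norm (y k)) \<longlonglongrightarrow> 1))"

end

theory Submission
  imports Defs
begin

text \<open>
  Finitely many functions of norm one that vanish at infinity are all smaller than \<open>\<epsilon>\<close> off a compact
  set, whose complement is open and non-empty. A norm-one function of the subspace that is at most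
  \<open>\<epsilon>\<close> off that complement is almost disjointly supported from each of the given ones.
\<close>

text \<open>Pointwise, one summand has norm at most \<open>\<epsilon>\<close> and the other at most
  1.\<close>

lemma norm_add_le_of_almost_disjoint:
  fixes f g :: "'a::topological_space \<Rightarrow>\<^sub>C 'k::real_normed_vector"
  assumes "norm f \<le> 1" "norm g \<le> 1"
    and "\<And>t. norm (f t) \<le> \<epsilon> \<or> norm (g t) \<le> \<epsilon>"
  shows "norm (f + g) \<le> 1 + \<epsilon>"
proof (rule norm_bound)
  fix t
  have "norm (f t) \<le> 1" "norm (g t) \<le> 1"
    using norm_bounded[of f t] norm_bounded[of g t] assms(1,2) by linarith+
  then show "norm ((f + g) t) \<le> 1 + \<epsilon>"
    using assms(3)[of t] norm_triangle_ineq[of "f t" "g t"] by auto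
qed

text \<open>Since \<open>u\<close> is the midpoint of \<open>u + v\<close> and \<open>u - v\<close>,
  the two norms sum to at least 2, so the upper bound on either one forces the lower bound
  \<open>1 - \<epsilon>\<close> on the other.\<close>

lemma abs_norm_add_sub_one_le:
  fixes u v :: "'v::real_normed_vector"
  assumes "norm u = 1" "norm (u + v) \<le> 1 + \<epsilon>" "norm (u - v) \<le> 1 + \<epsilon>"
  shows "\<bar>norm (u + v) - 1\<bar> \<le> \<epsilon>" and "\<bar>norm (u - v) - 1\<bar> \<le> \<epsilon>"
proof -
  have "(u + v) + (u - v) = 2 *\<^sub>R u"
    by (simp add: scaleR_2)
  then have "2 \<le> norm (u + v) + norm (u - v)"
    using norm_triangle_ineq[of "u + v" "u - v"] assms(1) by simp
  then show "\<bar>norm (u + v) - 1\<bar> \<le> \<epsilon>" "\<bar>norm (u - v) - 1\<bar> \<le> \<epsilon>"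
    using assms(2,3) by linarith+
qed

lemma somewhat_regular_almost_disjoint:
  fixes A :: "('a::t2_space \<Rightarrow>\<^sub>C 'k::real_normed_field) set"
  assumes "\<not> compact (UNIV :: 'a set)" "somewhat_regular A"
    and "finite F" "F \<subseteq> A" "0 < \<epsilon>" "\<epsilon> < 1"
  obtains g where "g \<in> A" "norm g = 1"
    "\<And>f t. f \<in> F \<Longrightarrow> norm (apply_bcontfun f t) \<le> \<epsilon> \<or> norm (g t) \<le> \<epsilon>"
proof -
  \<comment> \<open>Vanishing at infinity makes each superlevel set compact, and a finite union of
    them stays compact.\<close>
  define K where "K = (\<Union>f\<in>F. {t. \<epsilon> \<le> norm (apply_bcontfun f t)})"
  have "compact {t. \<epsilon> \<le> norm (apply_bcontfun f t)}" if "f \<in> F" for f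
    using that assms(2,4,5)
    unfolding somewhat_regular_def C0_def vanishes_at_infinity_def by blast
  then have "compact K"
    unfolding K_def using \<open>finite F\<close> by (intro compact_UN) auto
  \<comment> \<open>Compact sets are closed in a Hausdorff space, and \<open>K\<close> cannot be the
    whole non-compact space.\<close>
  then have "open (- K)" "- K \<noteq> {}"
    using assms(1) by (simp add: compact_imp_closed open_Compl, metis Compl_empty_eq double_compl)
  then obtain g where "g \<in> A" "norm g = 1" and g: "\<And>t. t \<in> K \<Longrightarrow> norm (g t) \<le> \<epsilon>"
    using assms(2,5,6) unfolding somewhat_regular_def by (metis Compl_iff)
  moreover have "norm (apply_bcontfun f t) \<le> \<epsilon> \<or> norm (g t) \<le> \<epsilon>" if "f \<in> F" for f t
    using g[of t] that unfolding K_def by force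
  ultimately show ?thesis
    using that by blast
qed

text \<open>Keeping the scalar field general lets one argument cover both real and complex
  functions.\<close>

lemma somewhat_regular_imp_almost_square:
  fixes A :: "('a::t2_space \<Rightarrow>\<^sub>C 'k::real_normed_field) set"
  assumes "\<not> compact (UNIV :: 'a set)" "somewhat_regular A"
  shows "almost_square A"
  unfolding almost_square_def
proof (intro allI impI)
  fix n :: nat and x :: "nat \<Rightarrow> 'a \<Rightarrow>\<^sub>C 'k"
  assume x: "\<forall>i\<in>{1..n}. x i \<in> A \<and> norm (x i) = 1"
  \<comment> \<open>The double successor starts the sequence at 1/2, because somewhat regularity
    only provides functions for \<open>\<epsilon> < 1\<close>.\<close>
  define \<epsilon> where "\<epsilon> k = inverse (real (Suc (Suc k)))" for k
  have \<epsilon>: "0 < \<epsilon> k" "\<epsilon> k < 1" for k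
    by (simp_all add: \<epsilon>_def field_simps)
  have \<epsilon>_tendsto: "\<epsilon> \<longlonglongrightarrow> 0"
    unfolding \<epsilon>_def using LIMSEQ_inverse_real_of_nat by (rule LIMSEQ_Suc)
  have "\<exists>g. g \<in> A \<and> norm g = 1 \<and>
      (\<forall>i\<in>{1..n}. \<forall>t. norm (x i t) \<le> \<epsilon> k \<or> norm (g t) \<le> \<epsilon> k)" for k
    using somewhat_regular_almost_disjoint[OF assms, of "x ` {1..n}" "\<epsilon> k"] x \<epsilon>[of k]
    by (metis finite_atLeastAtMost finite_imageI image_subsetI imageI)
  then obtain y where y: "\<And>k. y k \<in> A" "\<And>k. norm (y k) = 1"
    and disj: "\<And>k i t. i \<in> {1..n} \<Longrightarrow> norm (x i t) \<le> \<epsilon> k \<or> norm (y k t) \<le> \<epsilon> k"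
    by metis
  have dist: "\<bar>norm (x i + y k) - 1\<bar> \<le> \<epsilon> k" "\<bar>norm (x i - y k) - 1\<bar> \<le> \<epsilon> k"
    if "i \<in> {1..n}" for i k
  proof -
    have "norm (x i + y k) \<le> 1 + \<epsilon> k"
      using x y disj that by (intro norm_add_le_of_almost_disjoint) auto
    \<comment> \<open>Negating \<open>y k\<close> changes no pointwise norm, so the bound for sums
      also covers differences.\<close>
    moreover have "norm (x i + - y k) \<le> 1 + \<epsilon> k"
      using x y disj that by (intro norm_add_le_of_almost_disjoint) auto
    ultimately show "\<bar>norm (x i + y k) - 1\<bar> \<le> \<epsilon> k" "\<bar>norm (x i - y k) - 1\<bar> \<le> \<epsilon> k"
      using abs_norm_add_sub_one_le[of "x i" "y k" "\<epsilon> k"] x that by auto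
  qed
  \<comment> \<open>Both distances to 1 are squeezed by the null sequence
    \<open>\<epsilon>\<close>.\<close>
  have "(\<lambda>k. norm (x i + y k)) \<longlonglongrightarrow> 1" "(\<lambda>k. norm (x i - y k)) \<longlonglongrightarrow> 1" if "i \<in> {1..n}" for i
    by (rule LIM_zero_cancel, rule Lim_null_comparison[OF _ \<epsilon>_tendsto],
        simp add: dist[OF that])+
  with y show "\<exists>y. (\<forall>k. y k \<in> A \<and> norm (y k) \<le> 1) \<and>
      (\<forall>i\<in>{1..n}. (\<lambda>k. norm (x i + y k)) \<longlonglongrightarrow> 1 \<and> (\<lambda>k. norm (x i - y k)) \<longlonglongrightarrow> 1) \<and>
      (\<lambda>k. norm (y k)) \<longlonglongrightarrow> 1"
    by (intro exI[of _ y]) simp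
qed

theorem theorem2p5:
  assumes "locally_compact_space (euclidean :: 'a::t2_space topology)"
    and "infinite (UNIV :: 'a set)"
    and "\<not> compact (UNIV :: 'a set)"
  shows "(\<forall>A :: ('a \<Rightarrow>\<^sub>C real) set. somewhat_regular A \<longrightarrow> almost_square A) \<and>
         (\<forall>A :: ('a \<Rightarrow>\<^sub>C complex) set. somewhat_regular A \<longrightarrow> almost_square A)"
  by (intro conjI allI impI somewhat_regular_imp_almost_square[OF assms(3)])

end
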